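(* Let $T$ be an $n$-simplex, let $k, r\in\mathbb{N}_0$, and let $\mathcal{I}_{k,r} : \mathcal{P}_{r}\Lambda^{k}(T) \to \mathring{\mathcal{P}}^{-}_{r+k+1}\Lambda^{n-k}(T)$ and $\mathcal{J}_{k,r} : \mathcal{P}_{r+1}^{-}\Lambda^{k}(T) \to \mathring{\mathcal{P}}_{r+k+1}\Lambda^{n-k}(T)$ be the canonical isomorphisms. Let $\pi\in\mathrm{Perm}(n)$ with induced simplicial symmetry $S_\pi\in\mathrm{Sym}(T)$. Then $$S_{\pi}^{*}\mathcal{I}_{k,r}=\epsilon(\pi)\,\mathcal{I}_{k,r}S_{\pi}^{*},\qquad S_{\pi}^{*}\mathcal{J}_{k,r}=\epsilon(\pi)\,\mathcal{J}_{k,r}S_{\pi}^{*},$$ $$S_{\pi}^{*}\mathcal{I}_{k,r}^{-1}=\epsilon(\pi)\,\mathcal{I}_{k,r}^{-1}S_{\pi}^{*},\qquad S_{\pi}^{*}\mathcal{J}_{k,r}^{-1}=\epsilon(\pi)\,\mathcal{J}_{k,r}^{-1}S_{\pi}^{*}.$$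
   Context: **Simplices and symmetries.** $T$ is the convex hull of affinely independent points $v_0,\dots,v_n$ in a Euclidean space, with this vertex order. $[0:n]=\{0,\dots,n\}$; $\mathrm{Perm}(n)$ is the group of permutations of $[0:n]$ and $\epsilon(\pi)\in\{1,-1\}$ is the sign of $\pi$. $\mathrm{Sym}(T)$ is the group of affine automorphisms of $T$; $\pi\in\mathrm{Perm}(n)$ induces $S_\pi\in\mathrm{Sym}(T)$, $S_\pi(v_i)=v_{\pi^{-1}(i)}$, and $S_\pi^*$ is the pullback of differential forms; it maps each of the spaces below into itself. **Forms.** $\lambda_0,\dots,\lambda_n$ are the barycentric coordinates of $T$, $d\lambda_i$ their exterior derivatives. $A(r,n)$ is the set of $\alpha:[0:n]\to\mathbb{N}_0$ with $\sum_i\alpha(i)=r$; $\lambda^\alpha=\prod_i\lambda_i^{\alpha(i)}$. $\Sigma(k,n)$ and $\Sigma_0(k,n)$ are the sets of strictly increasing maps $\{1,\dots,k\}\to[0:n]$ and $\{0,\dots,k\}\to[0:n]$ ($\Sigma(0,n)=\{\emptyset\}$). $d\lambda_\sigma=d\lambda_{\sigma(1)}\wedge\dots\wedge d\lambda_{\sigma(k)}$ ($=1$ if $k=0$), $\phi_\rho=\sum_{i=0}^k(-1)^i\lambda_{\rho(i)}\,d\lambda_{\rho(0)}\wedge\dots\widehat{d\lambda_{\rho(i)}}\dots\wedge d\lambda_{\rho(k)}$ (Whitney form), $\lambda_\sigma=\prod_{i=1}^k\lambda_{\sigma(i)}$, $\lambda_\rho=\prod_{i=0}^k\lambda_{\rho(i)}$.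 $\sigma^c\in\Sigma_0(n-k,n)$, $\rho^c\in\Sigma(n-k,n)$ are the increasing enumerations of the complements in $[0:n]$ of the ranges of $\sigma\in\Sigma(k,n)$, $\rho\in\Sigma_0(k,n)$; $\epsilon(\sigma,\sigma^c)$, resp. $\epsilon(\rho^c,\rho)$, is the sign of the permutation sorting the concatenated sequence ($\sigma$ then $\sigma^c$, resp. $\rho^c$ then $\rho$) in ascending order. **Spaces** (coefficients in $\mathbb{F}\in\{\mathbb{R},\mathbb{C}\}$). $\mathcal{P}_r\Lambda^k(T)$ is the span of the $\lambda^\alpha d\lambda_\sigma$, $\alpha\in A(r,n)$, $\sigma\in\Sigma(k,n)$; $\mathcal{P}_r^-\Lambda^k(T)$ is the span of the $\lambda^\alpha\phi_\rho$, $\alpha\in A(r-1,n)$, $\rho\in\Sigma_0(k,n)$; they are zero for $k\notin[0:n]$. $\mathring{\mathcal{P}}_r\Lambda^k(T)$ and $\mathring{\mathcal{P}}^-_r\Lambda^k(T)$ are the subspaces of forms whose pullback to every proper subsimplex of $T$ vanishes. **Canonical isomorphisms.** $\mathcal{I}_{k,r}$ and $\mathcal{J}_{k,r}$ are the (well-defined) linear isomorphisms uniquely determined by $\mathcal{I}_{k,r}(\lambda^\alpha d\lambda_\sigma)=\epsilon(\sigma,\sigma^c)\lambda^\alpha\lambda_\sigma\phi_{\sigma^c}$ and $\mathcal{J}_{k,r}(\lambda^\alpha\phi_\rho)=\epsilon(\rho^c,\rho)\lambda^\alpha\lambda_\rho d\lambda_{\rho^c}$ for $\alpha\in A(r,n)$,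 $\sigma\in\Sigma(k,n)$, $\rho\in\Sigma_0(k,n)$ (they are maps between zero spaces if $k\notin[0:n]$). *)

theory Defs
  imports "HOL-Analysis.Analysis" "HOL-Combinatorics.Combinatorics" "HOL-Library.Function_Algebras"
begin

section \<open>Differential forms on a simplex\<close>

text \<open>
  A \<open>k\<close>-form on a simplex is encoded as a function of a point and a list of \<open>k\<close> tangent
  vectors. It has the value 0 when the point is not in the simplex, when the list does not have
  length \<open>k\<close>, or when one of the vectors is not tangent to the simplex; hence equality of forms on
  the simplex is equality of functions. The coefficient field is a type of class
  \<open>real_normed_field\<close>; by the Gelfand-Mazur theorem such a field is a copy of the reals or of the
  complex numbers.
\<close>

type_synonym ('a, 'f) form = "'a \<Rightarrow> 'a list \<Rightarrow> 'f"

definition form_scale :: "'f::field \<Rightarrow> ('a, 'f) form \<Rightarrow> ('a, 'f) form" where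
  "form_scale c \<omega> = (\<lambda>x ws. c * \<omega> x ws)"

global_interpretation forms: vector_space "form_scale :: 'f::field \<Rightarrow> ('a, 'f) form \<Rightarrow> ('a, 'f) form"
  by unfold_locales (auto simp: form_scale_def fun_eq_iff algebra_simps)

definition form_linear_on :: "('a, 'f::field) form set \<Rightarrow> (('a, 'f) form \<Rightarrow> ('a, 'f) form) \<Rightarrow> bool" where
  "form_linear_on V f \<longleftrightarrow>
     (\<forall>\<omega>\<in>V. \<forall>\<eta>\<in>V. f (\<omega> + \<eta>) = f \<omega> + f \<eta>) \<and>
     (\<forall>c. \<forall>\<omega>\<in>V. f (form_scale c \<omega>) = form_scale c (f \<omega>))"

definition fun_mult :: "('a \<Rightarrow> real) \<Rightarrow> ('a, 'f::real_normed_field) form \<Rightarrow> ('a, 'f) form" where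
  "fun_mult g \<omega> = (\<lambda>x ws. of_real (g x) * \<omega> x ws)"

definition tangent :: "'a::euclidean_space set \<Rightarrow> 'a set" where
  "tangent X = span {x - y |x y. x \<in> X \<and> y \<in> X}"

definition dir_deriv :: "('a::real_vector \<Rightarrow> 'b::real_normed_vector) \<Rightarrow> 'a \<Rightarrow> 'a \<Rightarrow> 'b" where
  "dir_deriv f x w = vector_derivative (\<lambda>t. f (x + t *\<^sub>R w)) (at 0)"

text \<open>
  Pullback along a map \<open>S\<close> whose domain is the simplex \<open>X\<close>. With \<open>S = id\<close> it is the pullback along
  the inclusion of \<open>X\<close> into a larger simplex.
\<close>

definition pullback :: "'a::euclidean_space set \<Rightarrow> ('a \<Rightarrow> 'a) \<Rightarrow> ('a, 'f::zero) form \<Rightarrow> ('a, 'f) form" where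
  "pullback X S \<omega> = (\<lambda>x ws.
     if x \<in> X \<and> set ws \<subseteq> tangent X then \<omega> (S x) (map (dir_deriv S x) ws) else 0)"


section \<open>Barycentric coordinates and their differentials\<close>

abbreviation splx :: "(nat \<Rightarrow> 'a::euclidean_space) \<Rightarrow> nat set \<Rightarrow> 'a set" where
  "splx v I \<equiv> convex hull (v ` I)"

text \<open>
  The barycentric coordinates are defined on the whole affine hull of the vertices, so that the
  directional derivatives in tangent directions exist at boundary points, too.
\<close>

definition bary :: "nat \<Rightarrow> (nat \<Rightarrow> 'a::euclidean_space) \<Rightarrow> nat \<Rightarrow> 'a \<Rightarrow> real" where
  "bary n v i x = (SOME c. (\<Sum>j=0..n. c j) = 1 \<and> (\<Sum>j=0..n. c j *\<^sub>R v j) = x) i"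

definition dbary :: "nat \<Rightarrow> (nat \<Rightarrow> 'a::euclidean_space) \<Rightarrow> nat \<Rightarrow> 'a \<Rightarrow> 'a \<Rightarrow> real" where
  "dbary n v i = dir_deriv (bary n v i)"

text \<open>
  The wedge product of the one-forms \<open>d\<lambda>\<^sub>j\<close>, where \<open>j\<close> runs through the list \<open>js\<close>: its value on
  vectors \<open>ws\<close> is the determinant of the matrix with entries \<open>d\<lambda>\<^bsub>js ! i\<^esub> (ws ! l)\<close>.
\<close>

definition dlam :: "nat \<Rightarrow> (nat \<Rightarrow> 'a::euclidean_space) \<Rightarrow> nat list \<Rightarrow> ('a, 'f::real_normed_field) form" where
  "dlam n v js = (\<lambda>x ws.
     if x \<in> splx v {0..n} \<and> length ws = length js \<and> set ws \<subseteq> tangent (splx v {0..n})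
     then \<Sum>p | p permutes {..<length js}.
            of_int (sign p) * (\<Prod>i<length js. of_real (dbary n v (js ! i) x (ws ! p i)))
     else 0)"

definition whitney :: "nat \<Rightarrow> (nat \<Rightarrow> 'a::euclidean_space) \<Rightarrow> nat list \<Rightarrow> ('a, 'f::real_normed_field) form" where
  "whitney n v \<rho> = (\<Sum>i<length \<rho>.
     form_scale ((-1) ^ i) (fun_mult (bary n v (\<rho> ! i)) (dlam n v (take i \<rho> @ drop (Suc i) \<rho>))))"

definition lam_pow :: "nat \<Rightarrow> (nat \<Rightarrow> 'a::euclidean_space) \<Rightarrow> (nat \<Rightarrow> nat) \<Rightarrow> 'a \<Rightarrow> real" where
  "lam_pow n v \<alpha> x = (\<Prod>i=0..n. bary n v i x ^ \<alpha> i)"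

definition lam_prod :: "nat \<Rightarrow> (nat \<Rightarrow> 'a::euclidean_space) \<Rightarrow> nat list \<Rightarrow> 'a \<Rightarrow> real" where
  "lam_prod n v js x = (\<Prod>i<length js. bary n v (js ! i) x)"


section \<open>Index sets\<close>

text \<open>The degree of multi-indices is an integer because it is \<open>r - 1\<close> for the trimmed spaces.\<close>

definition multi_indices :: "int \<Rightarrow> nat \<Rightarrow> (nat \<Rightarrow> nat) set" where
  "multi_indices r n = {\<alpha> \<in> {0..n} \<rightarrow>\<^sub>E UNIV. int (\<Sum>i=0..n. \<alpha> i) = r}"

text \<open>
  A strictly increasing map from \<open>{1..k}\<close> or \<open>{0..k}\<close> to \<open>{0..n}\<close> is encoded as the list of its
  values.
\<close>

definition Sigma1 :: "nat \<Rightarrow> nat \<Rightarrow> nat list set" where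
  "Sigma1 k n = {\<sigma>. length \<sigma> = k \<and> sorted_wrt (<) \<sigma> \<and> set \<sigma> \<subseteq> {0..n}}"

definition Sigma0 :: "nat \<Rightarrow> nat \<Rightarrow> nat list set" where
  "Sigma0 k n = {\<rho>. length \<rho> = Suc k \<and> sorted_wrt (<) \<rho> \<and> set \<rho> \<subseteq> {0..n}}"

definition compl_list :: "nat \<Rightarrow> nat list \<Rightarrow> nat list" where
  "compl_list n js = sorted_list_of_set ({0..n} - set js)"

text \<open>Sign of the permutation sorting the concatenation of two lists (without repeated entries).\<close>

definition concat_sign :: "nat list \<Rightarrow> nat list \<Rightarrow> int" where
  "concat_sign xs ys =
     sign (THE p. p permutes {..<length (xs @ ys)} \<and> permute_list p (xs @ ys) = sort (xs @ ys))"


section \<open>Spaces of polynomial forms\<close>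

text \<open>The form degree is an integer because the degree \<open>n - k\<close> is negative for \<open>k > n\<close>.\<close>

definition poly_forms ::
    "nat \<Rightarrow> (nat \<Rightarrow> 'a::euclidean_space) \<Rightarrow> nat \<Rightarrow> int \<Rightarrow> ('a, 'f::real_normed_field) form set" where
  "poly_forms n v r k =
     (if 0 \<le> k \<and> k \<le> int n
      then forms.span {fun_mult (lam_pow n v \<alpha>) (dlam n v \<sigma>) |\<alpha> \<sigma>.
             \<alpha> \<in> multi_indices (int r) n \<and> \<sigma> \<in> Sigma1 (nat k) n}
      else {0})"

definition trimmed_forms ::
    "nat \<Rightarrow> (nat \<Rightarrow> 'a::euclidean_space) \<Rightarrow> nat \<Rightarrow> int \<Rightarrow> ('a, 'f::real_normed_field) form set" where
  "trimmed_forms n v r k =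
     (if 0 \<le> k \<and> k \<le> int n
      then forms.span {fun_mult (lam_pow n v \<alpha>) (whitney n v \<rho>) |\<alpha> \<rho>.
             \<alpha> \<in> multi_indices (int r - 1) n \<and> \<rho> \<in> Sigma0 (nat k) n}
      else {0})"

definition zero_trace :: "nat \<Rightarrow> (nat \<Rightarrow> 'a::euclidean_space) \<Rightarrow> ('a, 'f::zero) form \<Rightarrow> bool" where
  "zero_trace n v \<omega> \<longleftrightarrow> (\<forall>I. I \<noteq> {} \<and> I \<subset> {0..n} \<longrightarrow> pullback (splx v I) id \<omega> = 0)"

definition poly_forms0 ::
    "nat \<Rightarrow> (nat \<Rightarrow> 'a::euclidean_space) \<Rightarrow> nat \<Rightarrow> int \<Rightarrow> ('a, 'f::real_normed_field) form set" where
  "poly_forms0 n v r k = {\<omega> \<in> poly_forms n v r k. zero_trace n v \<omega>}"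

definition trimmed_forms0 ::
    "nat \<Rightarrow> (nat \<Rightarrow> 'a::euclidean_space) \<Rightarrow> nat \<Rightarrow> int \<Rightarrow> ('a, 'f::real_normed_field) form set" where
  "trimmed_forms0 n v r k = {\<omega> \<in> trimmed_forms n v r k. zero_trace n v \<omega>}"


section \<open>Canonical isomorphisms and symmetries\<close>

text \<open>
  The following conditions determine \<open>I\<close> and \<open>J\<close> uniquely on their domains, \<open>poly_forms n v r k\<close>
  and \<open>trimmed_forms n v (r + 1) k\<close>; the values elsewhere are irrelevant.
\<close>

definition canonical_I :: "nat \<Rightarrow> (nat \<Rightarrow> 'a::euclidean_space) \<Rightarrow> nat \<Rightarrow> nat \<Rightarrow>
    (('a, 'f::real_normed_field) form \<Rightarrow> ('a, 'f) form) \<Rightarrow> bool" where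
  "canonical_I n v k r I \<longleftrightarrow>
     form_linear_on (poly_forms n v r (int k)) I \<and>
     bij_betw I (poly_forms n v r (int k)) (trimmed_forms0 n v (r + k + 1) (int n - int k)) \<and>
     (\<forall>\<alpha>\<in>multi_indices (int r) n. \<forall>\<sigma>\<in>Sigma1 k n.
        I (fun_mult (lam_pow n v \<alpha>) (dlam n v \<sigma>)) =
          form_scale (of_int (concat_sign \<sigma> (compl_list n \<sigma>)))
            (fun_mult (\<lambda>x. lam_pow n v \<alpha> x * lam_prod n v \<sigma> x) (whitney n v (compl_list n \<sigma>))))"

definition canonical_J :: "nat \<Rightarrow> (nat \<Rightarrow> 'a::euclidean_space) \<Rightarrow> nat \<Rightarrow> nat \<Rightarrow>
    (('a, 'f::real_normed_field) form \<Rightarrow> ('a, 'f) form) \<Rightarrow> bool" where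
  "canonical_J n v k r J \<longleftrightarrow>
     form_linear_on (trimmed_forms n v (r + 1) (int k)) J \<and>
     bij_betw J (trimmed_forms n v (r + 1) (int k)) (poly_forms0 n v (r + k + 1) (int n - int k)) \<and>
     (\<forall>\<alpha>\<in>multi_indices (int r) n. \<forall>\<rho>\<in>Sigma0 k n.
        J (fun_mult (lam_pow n v \<alpha>) (whitney n v \<rho>)) =
          form_scale (of_int (concat_sign (compl_list n \<rho>) \<rho>))
            (fun_mult (\<lambda>x. lam_pow n v \<alpha> x * lam_prod n v \<rho> x) (dlam n v (compl_list n \<rho>))))"

text \<open>The affine map that takes each vertex \<open>v i\<close> to \<open>v (inv \<pi> i)\<close>.\<close>

definition simplex_sym :: "nat \<Rightarrow> (nat \<Rightarrow> 'a::euclidean_space) \<Rightarrow> (nat \<Rightarrow> nat) \<Rightarrow> 'a \<Rightarrow> 'a" where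
  "simplex_sym n v \<pi> x = (\<Sum>i=0..n. bary n v i x *\<^sub>R v (inv \<pi> i))"

definition sym_pullback :: "nat \<Rightarrow> (nat \<Rightarrow> 'a::euclidean_space) \<Rightarrow> (nat \<Rightarrow> nat) \<Rightarrow>
    ('a, 'f::real_normed_field) form \<Rightarrow> ('a, 'f) form" where
  "sym_pullback n v \<pi> = pullback (splx v {0..n}) (simplex_sym n v \<pi>)"

end

theory Submission
  imports Defs "Jordan_Normal_Form.Determinant"
begin

text \<open>
  The pullback along the symmetry sends \<open>\<lambda>\<^sub>i\<close> to \<open>\<lambda>\<^bsub>\<pi> i\<^esub>\<close>, hence a product of differentials or a
  Whitney form over a list \<open>js\<close> to the one over \<open>map \<pi> js\<close>. Both are determinants with one row per
  list entry, so sorting \<open>map \<pi> js\<close> costs the sign of the sorting permutation. On a generator over \<open>\<sigma>\<close>,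
  the signs from sorting \<open>map \<pi> \<sigma>\<close> and its complement, together with the signs in the canonical
  isomorphisms, combine to the sign of \<open>\<pi>\<close>, because composing the list \<open>\<sigma>, \<sigma>\<^sup>c\<close>, read as a permutation
  of the vertices, with \<open>\<pi>\<close> multiplies its sign by that of \<open>\<pi>\<close>. For the inverses it suffices that the
  domains are invariant: if \<open>S\<^sup>* I = \<epsilon> I S\<^sup>*\<close>, then \<open>S\<^sup>* (I \<eta>)\<close> is the image of \<open>\<epsilon> S\<^sup>* \<eta>\<close>.
\<close>

section \<open>Barycentric coordinates and simplicial symmetries\<close>

lemma nth_le: "set js \<subseteq> {0..n} \<Longrightarrow> i < length js \<Longrightarrow> js ! i \<le> (n::nat)"
  using nth_mem[of i js] by (auto simp only: subset_iff atLeastAtMost_iff)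

text \<open>\<open>affine_dependent\<close> sees only the set of vertices; injectivity of
  \<open>v\<close> is what excludes repeated ones.\<close>

locale affine_simplex =
  fixes n :: nat and v :: "nat \<Rightarrow> 'a::euclidean_space"
  assumes inj_v: "inj_on v {0..n}" and indep_v: "\<not> affine_dependent (v ` {0..n})"
begin

section \<open>Points and tangent vectors as combinations of the vertices\<close>

abbreviation comb :: "(nat \<Rightarrow> real) \<Rightarrow> 'a" where
  "comb c \<equiv> \<Sum>j=0..n. c j *\<^sub>R v j"

abbreviation X :: "'a set" where
  "X \<equiv> splx v {0..n}"

text \<open>Affine independence in terms of indices: carried to the vertices along the inverse of
  \<open>v\<close>, a family \<open>c\<close> with a nonzero entry would be an affine
  dependence.\<close>

lemma comb_eq_0:
  assumes "(\<Sum>j=0..n. c j) = 0" "comb c = 0" "i \<le> n"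
  shows "c i = 0"
proof (rule ccontr)
  assume "c i \<noteq> 0"
  define U where "U = c \<circ> inv_into {0..n} v"
  have U: "U (v j) = c j" if "j \<in> {0..n}" for j
    using that inj_v by (simp add: U_def)
  have "sum U (v ` {0..n}) = 0" "(\<Sum>x\<in>v ` {0..n}. U x *\<^sub>R x) = 0"
    using assms U by (simp_all add: sum.reindex[OF inj_v])
  moreover have "v i \<in> v ` {0..n}" "U (v i) \<noteq> 0"
    using \<open>i \<le> n\<close> \<open>c i \<noteq> 0\<close> U by auto
  ultimately have "affine_dependent (v ` {0..n})"
    unfolding affine_dependent_explicit_finite[OF finite_imageI[OF finite_atLeastAtMost]] by blast
  then show False using indep_v by simp
qed

text \<open>Two coefficient families admissible for the \<open>SOME\<close> in \<open>bary\<close>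
  differ by a family with sum 0 and combination 0, so they agree on the indices up to
  \<open>n\<close>. Coefficients of any sign are allowed, which covers lines leaving the
  simplex.\<close>

lemma bary_comb:
  assumes "(\<Sum>j=0..n. c j) = 1" "i \<le> n"
  shows "bary n v i (comb c) = c i"
proof -
  define d where "d = (SOME d. (\<Sum>j=0..n. d j) = 1 \<and> comb d = comb c)"
  have d: "(\<Sum>j=0..n. d j) = 1 \<and> comb d = comb c"
    unfolding d_def by (rule someI[of _ c]) (use assms in simp)
  have "d i - c i = 0"
    by (rule comb_eq_0[of "\<lambda>j. d j - c j"])
      (use d assms in \<open>auto simp: sum_subtractf scaleR_diff_left\<close>)
  then show ?thesis by (simp add: bary_def d_def)
qed

lemma in_simplex_iff:
  "x \<in> X \<longleftrightarrow> (\<exists>c. (\<forall>i\<le>n. 0 \<le> c i) \<and> (\<Sum>j=0..n. c j) = 1 \<and> x = comb c)"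
proof
  assume "x \<in> X"
  then obtain u where u: "\<forall>y\<in>v ` {0..n}. 0 \<le> u y" "sum u (v ` {0..n}) = 1"
    "(\<Sum>y\<in>v ` {0..n}. u y *\<^sub>R y) = x"
    unfolding convex_hull_finite[OF finite_imageI[OF finite_atLeastAtMost]] by auto
  then show "\<exists>c. (\<forall>i\<le>n. 0 \<le> c i) \<and> (\<Sum>j=0..n. c j) = 1 \<and> x = comb c"
    by (intro exI[of _ "u \<circ> v"]) (auto simp: sum.reindex[OF inj_v])
next
  assume "\<exists>c. (\<forall>i\<le>n. 0 \<le> c i) \<and> (\<Sum>j=0..n. c j) = 1 \<and> x = comb c"
  then obtain c where c: "\<forall>i\<le>n. 0 \<le> c i" "(\<Sum>j=0..n. c j) = 1" "x = comb c" by blast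
  show "x \<in> X"
    unfolding c(3)
    by (rule convex_sum) (use c in \<open>auto intro: hull_inc\<close>)
qed

text \<open>Differences of points of the simplex have coefficient sum 0, and such combinations form
  a subspace, which therefore contains the span \<open>tangent X\<close>.\<close>

lemma in_tangent_iff: "w \<in> tangent X \<longleftrightarrow> (\<exists>c. (\<Sum>j=0..n. c j) = 0 \<and> w = comb c)"
proof
  let ?S = "{w. \<exists>c. (\<Sum>j=0..n. c j) = 0 \<and> w = comb c}"
  have "subspace ?S"
  proof (rule subspaceI)
    show "0 \<in> ?S" by (auto intro!: exI[of _ "\<lambda>_. 0"])
    fix a b assume "a \<in> ?S" "b \<in> ?S"
    then obtain c d where "(\<Sum>j=0..n. c j) = 0" "a = comb c" "(\<Sum>j=0..n. d j) = 0" "b = comb d"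
      by auto
    then show "a + b \<in> ?S"
      by (auto intro!: exI[of _ "\<lambda>j. c j + d j"] simp: sum.distrib scaleR_add_left)
  next
    fix r :: real and a assume "a \<in> ?S"
    then obtain c where "(\<Sum>j=0..n. c j) = 0" "a = comb c" by auto
    then show "r *\<^sub>R a \<in> ?S"
      by (auto intro!: exI[of _ "\<lambda>j. r * c j"] simp: sum_distrib_left[symmetric] scaleR_sum_right)
  qed
  moreover have "{x - y |x y. x \<in> X \<and> y \<in> X} \<subseteq> ?S"
  proof clarify
    fix x y assume "x \<in> X" "y \<in> X"
    then obtain c d where "(\<Sum>j=0..n. c j) = 1" "x = comb c" "(\<Sum>j=0..n. d j) = 1" "y = comb d"
      unfolding in_simplex_iff by auto
    then show "\<exists>c. (\<Sum>j=0..n. c j) = 0 \<and> x - y = comb c"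
      by (auto intro!: exI[of _ "\<lambda>j. c j - d j"] simp: sum_subtractf scaleR_diff_left)
  qed
  ultimately have "tangent X \<subseteq> ?S"
    unfolding tangent_def by (rule span_minimal[rotated])
  moreover assume "w \<in> tangent X"
  ultimately show "\<exists>c. (\<Sum>j=0..n. c j) = 0 \<and> w = comb c" by auto
next
  assume "\<exists>c. (\<Sum>j=0..n. c j) = 0 \<and> w = comb c"
  then obtain c where c: "(\<Sum>j=0..n. c j) = 0" "w = comb c" by blast
  \<comment> \<open>Since the coefficients sum to 0, \<open>v 0\<close> can be subtracted from every
    vertex; this puts \<open>w\<close> into the span of differences of vertices.\<close>
  have "w = (\<Sum>j=0..n. c j *\<^sub>R (v j - v 0))"
    using c by (simp add: scaleR_diff_right sum_subtractf scaleR_sum_left[symmetric])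
  also have "\<dots> \<in> tangent X"
    unfolding tangent_def
  proof (intro span_sum span_scale span_base)
    fix j assume "j \<in> {0..n}"
    then have "v j \<in> X" "v 0 \<in> X" by (auto intro: hull_inc)
    then show "v j - v 0 \<in> {x - y |x y. x \<in> X \<and> y \<in> X}" by blast
  qed
  finally show "w \<in> tangent X" .
qed

text \<open>On the line through \<open>comb c\<close> in direction \<open>comb d\<close> the
  coordinate is the affine function \<open>c i + t * d i\<close>. The line may leave the simplex, so
  boundary points are no exception.\<close>

lemma dbary_comb:
  assumes "(\<Sum>j=0..n. c j) = 1" "(\<Sum>j=0..n. d j) = 0" "i \<le> n"
  shows "dbary n v i (comb c) (comb d) = d i"
proof -
  have "bary n v i (comb c + t *\<^sub>R comb d) = c i + t * d i" for t
  proof -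
    have "comb c + t *\<^sub>R comb d = comb (\<lambda>j. c j + t * d j)"
      by (simp add: sum.distrib scaleR_add_left scaleR_sum_right)
    moreover have "(\<Sum>j=0..n. c j + t * d j) = 1"
      using assms by (simp add: sum.distrib sum_distrib_left[symmetric])
    ultimately show ?thesis using bary_comb[of "\<lambda>j. c j + t * d j" i] assms(3) by simp
  qed
  moreover have "((\<lambda>t. c i + t * d i) has_vector_derivative d i) (at 0)"
    by (auto intro!: derivative_eq_intros)
  ultimately show ?thesis
    by (simp add: dbary_def dir_deriv_def vector_derivative_at)
qed

section \<open>Linearity of the pullback\<close>

lemma sym_pullback_apply:
  "sym_pullback n v \<pi> \<omega> x ws =
     (if x \<in> X \<and> set ws \<subseteq> tangent X
      then \<omega> (simplex_sym n v \<pi> x) (map (dir_deriv (simplex_sym n v \<pi>) x) ws) else 0)"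
  by (simp add: sym_pullback_def pullback_def)

lemma sym_pullback_add: "sym_pullback n v \<pi> (\<omega> + \<eta>) = sym_pullback n v \<pi> \<omega> + sym_pullback n v \<pi> \<eta>"
  for \<omega> \<eta> :: "('a, 'f::real_normed_field) form"
  by (auto simp: fun_eq_iff sym_pullback_apply)

lemma sym_pullback_scale: "sym_pullback n v \<pi> (form_scale c \<omega>) = form_scale c (sym_pullback n v \<pi> \<omega>)"
  by (auto simp: fun_eq_iff sym_pullback_apply form_scale_def)

lemma sym_pullback_sum: "sym_pullback n v \<pi> (\<Sum>i\<in>A. f i) = (\<Sum>i\<in>A. sym_pullback n v \<pi> (f i))"
  for f :: "'b \<Rightarrow> ('a, 'f::real_normed_field) form"
proof (induction A rule: infinite_finite_induct)
  case (insert i A)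
  then show ?case by (simp only: sum.insert[OF insert.hyps] sym_pullback_add)
qed (auto simp: fun_eq_iff sym_pullback_apply)

text \<open>The coefficient has to be known on \<open>X\<close> only, because a pullback is 0
  elsewhere.\<close>

lemma sym_pullback_fun_mult:
  assumes "\<And>x. x \<in> X \<Longrightarrow> g (simplex_sym n v \<pi> x) = h x"
  shows "sym_pullback n v \<pi> (fun_mult g \<omega>) = fun_mult h (sym_pullback n v \<pi> \<omega>)"
  using assms by (auto simp: fun_eq_iff sym_pullback_apply fun_mult_def)

section \<open>Action of a vertex permutation on coordinates and forms\<close>

context
  fixes \<pi> :: "nat \<Rightarrow> nat"
  assumes perm: "\<pi> permutes {0..n}"
begin

lemma perm_le: "\<pi> i \<le> n \<longleftrightarrow> i \<le> n"
  using permutes_in_image[OF perm, of i] by simp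

lemma sum_perm: "(\<Sum>j=0..n. c (\<pi> j)) = (\<Sum>j=0..n. c j)"
  using sum.permute[OF perm, of c] by (simp add: o_def)

text \<open>Substituting \<open>\<pi> j\<close> for the summation index turns the vertex with index
  \<open>inv \<pi> i\<close> into \<open>v j\<close>. Every \<open>\<pi>\<close> in the pullback
  rules below comes from this.\<close>

lemma simplex_sym_comb:
  assumes "(\<Sum>j=0..n. c j) = 1"
  shows "simplex_sym n v \<pi> (comb c) = comb (\<lambda>j. c (\<pi> j))"
proof -
  have "simplex_sym n v \<pi> (comb c) = (\<Sum>i=0..n. c i *\<^sub>R v (Hilbert_Choice.inv \<pi> i))"
    using assms by (simp add: simplex_sym_def bary_comb)
  also have "\<dots> = (\<Sum>j=0..n. c (\<pi> j) *\<^sub>R v (Hilbert_Choice.inv \<pi> (\<pi> j)))"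
    by (subst sum.permute[OF perm]) (simp add: o_def)
  finally show ?thesis by (simp add: permutes_inverses[OF perm])
qed

text \<open>The symmetry is affine, so its derivative permutes the coefficients of tangent vectors
  as the symmetry permutes those of points.\<close>

lemma dir_deriv_simplex_sym:
  assumes "(\<Sum>j=0..n. c j) = 1" "(\<Sum>j=0..n. d j) = 0"
  shows "dir_deriv (simplex_sym n v \<pi>) (comb c) (comb d) = comb (\<lambda>j. d (\<pi> j))"
proof -
  have "simplex_sym n v \<pi> (comb c + t *\<^sub>R comb d)
      = comb (\<lambda>j. c (\<pi> j)) + t *\<^sub>R comb (\<lambda>j. d (\<pi> j))" for t
  proof -
    have "comb c + t *\<^sub>R comb d = comb (\<lambda>j. c j + t * d j)"
      by (simp add: sum.distrib scaleR_add_left scaleR_sum_right)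
    moreover have "(\<Sum>j=0..n. c j + t * d j) = 1"
      using assms by (simp add: sum.distrib sum_distrib_left[symmetric])
    moreover have "comb (\<lambda>j. c (\<pi> j) + t * d (\<pi> j)) = comb (\<lambda>j. c (\<pi> j)) + t *\<^sub>R comb (\<lambda>j. d (\<pi> j))"
      by (simp add: sum.distrib scaleR_add_left scaleR_sum_right)
    ultimately show ?thesis by (simp only: simplex_sym_comb)
  qed
  moreover have "((\<lambda>t. comb (\<lambda>j. c (\<pi> j)) + t *\<^sub>R comb (\<lambda>j. d (\<pi> j)))
      has_vector_derivative comb (\<lambda>j. d (\<pi> j))) (at 0)"
    by (auto intro!: derivative_eq_intros)
  ultimately show ?thesis
    by (simp add: dir_deriv_def vector_derivative_at)
qed

lemma simplex_sym_in: "x \<in> X \<Longrightarrow> simplex_sym n v \<pi> x \<in> X"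
proof -
  assume "x \<in> X"
  then obtain c where c: "\<forall>i\<le>n. 0 \<le> c i" "(\<Sum>j=0..n. c j) = 1" "x = comb c"
    unfolding in_simplex_iff by blast
  show ?thesis
    unfolding in_simplex_iff
    by (rule exI[of _ "\<lambda>j. c (\<pi> j)"])
      (use c in \<open>simp add: simplex_sym_comb sum_perm perm_le\<close>)
qed

lemma bary_simplex_sym:
  assumes "x \<in> X" "i \<le> n"
  shows "bary n v i (simplex_sym n v \<pi> x) = bary n v (\<pi> i) x"
proof -
  obtain c where c: "(\<Sum>j=0..n. c j) = 1" "x = comb c"
    using assms(1) unfolding in_simplex_iff by blast
  then show ?thesis
    using assms(2) by (simp add: simplex_sym_comb bary_comb sum_perm perm_le)
qed

lemma dir_deriv_simplex_sym_tangent: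
  assumes "x \<in> X" "w \<in> tangent X"
  shows "dir_deriv (simplex_sym n v \<pi>) x w \<in> tangent X"
proof -
  obtain c d where c: "(\<Sum>j=0..n. c j) = 1" "x = comb c"
    and d: "(\<Sum>j=0..n. d j) = 0" "w = comb d"
    using assms unfolding in_simplex_iff in_tangent_iff by blast
  show ?thesis
    unfolding in_tangent_iff
    by (rule exI[of _ "\<lambda>j. d (\<pi> j)"]) (use c d in \<open>simp add: dir_deriv_simplex_sym sum_perm\<close>)
qed

lemma dbary_simplex_sym:
  assumes "x \<in> X" "w \<in> tangent X" "i \<le> n"
  shows "dbary n v i (simplex_sym n v \<pi> x) (dir_deriv (simplex_sym n v \<pi>) x w) = dbary n v (\<pi> i) x w"
proof -
  obtain c d where c: "(\<Sum>j=0..n. c j) = 1" "x = comb c"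
    and d: "(\<Sum>j=0..n. d j) = 0" "w = comb d"
    using assms unfolding in_simplex_iff in_tangent_iff by blast
  then show ?thesis
    using assms(3) by (simp add: simplex_sym_comb dir_deriv_simplex_sym dbary_comb sum_perm perm_le)
qed

text \<open>Even for increasing \<open>js\<close> the list \<open>map \<pi> js\<close> need not be
  increasing; hence the forms are studied over arbitrary lists.\<close>

lemma sym_pullback_dlam:
  assumes "set js \<subseteq> {0..n}"
  shows "sym_pullback n v \<pi> (dlam n v js) = (dlam n v (map \<pi> js) :: ('a, 'f::real_normed_field) form)"
proof (intro ext)
  fix x ws
  show "sym_pullback n v \<pi> (dlam n v js) x ws = (dlam n v (map \<pi> js) x ws :: 'f)"
  proof (cases "x \<in> X \<and> set ws \<subseteq> tangent X \<and> length ws = length js")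
    case True
    have "of_real (dbary n v (js ! i) (simplex_sym n v \<pi> x) (map (dir_deriv (simplex_sym n v \<pi>) x) ws ! p i))
        = (of_real (dbary n v (map \<pi> js ! i) x (ws ! p i)) :: 'f)"
      if "p permutes {..<length js}" "i < length js" for p i
    proof -
      have "p i < length js" using that permutes_in_image[OF that(1), of i] by simp
      moreover have "js ! i \<le> n" using that(2) assms by (auto intro: nth_le)
      moreover have "ws ! p i \<in> tangent X"
        using True \<open>p i < length js\<close> nth_mem[of "p i" ws] by auto
      ultimately show ?thesis using True that by (simp add: dbary_simplex_sym)
    qed
    moreover have "set (map (dir_deriv (simplex_sym n v \<pi>) x) ws) \<subseteq> tangent X"
      using True by (auto intro!: dir_deriv_simplex_sym_tangent)
    ultimately show ?thesis
      using True simplex_sym_in[of x] by (auto simp: sym_pullback_apply dlam_def intro!: sum.cong prod.cong)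
  next
    \<comment> \<open>Both sides are 0; mapping the derivative over \<open>ws\<close> does not
      repair a wrong length.\<close>
    case False
    then show ?thesis by (auto simp: sym_pullback_apply dlam_def)
  qed
qed

text \<open>Omitting the entry at position \<open>i\<close> commutes with \<open>map \<pi>\<close>,
  so the summands correspond one by one with equal signs.\<close>

lemma sym_pullback_whitney:
  assumes "set js \<subseteq> {0..n}"
  shows "sym_pullback n v \<pi> (whitney n v js) = (whitney n v (map \<pi> js) :: ('a, 'f::real_normed_field) form)"
proof -
  have "sym_pullback n v \<pi> (form_scale ((-1) ^ i) (fun_mult (bary n v (js ! i)) (dlam n v (take i js @ drop (Suc i) js))))
     = (form_scale ((-1) ^ i) (fun_mult (bary n v (map \<pi> js ! i))
          (dlam n v (take i (map \<pi> js) @ drop (Suc i) (map \<pi> js)))) :: ('a, 'f) form)"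
    if "i < length js" for i
  proof -
    have "js ! i \<le> n" using that assms by (auto intro: nth_le)
    moreover have "set (take i js @ drop (Suc i) js) \<subseteq> {0..n}"
      using assms set_take_subset[of i js] set_drop_subset[of "Suc i" js] by auto
    ultimately show ?thesis
      using that by (simp add: sym_pullback_scale sym_pullback_dlam take_map drop_map bary_simplex_sym
          sym_pullback_fun_mult[where h = "bary n v (\<pi> (js ! i))"])
  qed
  then show ?thesis by (simp add: whitney_def sym_pullback_sum)
qed

lemma lam_pow_simplex_sym:
  assumes "x \<in> X"
  shows "lam_pow n v \<alpha> (simplex_sym n v \<pi> x) = lam_pow n v (\<alpha> \<circ> Hilbert_Choice.inv \<pi>) x"
proof -
  have "lam_pow n v (\<alpha> \<circ> Hilbert_Choice.inv \<pi>) x = (\<Prod>i=0..n. bary n v (\<pi> i) x ^ (\<alpha> (Hilbert_Choice.inv \<pi> (\<pi> i))))"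
    unfolding lam_pow_def by (subst prod.permute[OF perm]) (simp add: o_def)
  then show ?thesis
    using assms by (simp add: lam_pow_def bary_simplex_sym permutes_inverses[OF perm])
qed

lemma lam_prod_simplex_sym:
  assumes "x \<in> X" "set js \<subseteq> {0..n}"
  shows "lam_prod n v js (simplex_sym n v \<pi> x) = lam_prod n v (map \<pi> js) x"
proof -
  have "js ! i \<le> n" if "i < length js" for i
    using that assms by (auto intro: nth_le)
  then show ?thesis using assms(1) by (simp add: lam_prod_def bary_simplex_sym)
qed

lemma multi_indices_comp_inv:
  assumes "\<alpha> \<in> multi_indices d n"
  shows "\<alpha> \<circ> Hilbert_Choice.inv \<pi> \<in> multi_indices d n"
proof -
  have "(\<Sum>i=0..n. \<alpha> (Hilbert_Choice.inv \<pi> i)) = (\<Sum>i=0..n. \<alpha> i)"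
    using sum.permute[OF permutes_inv[OF perm], of \<alpha>] by (simp add: o_def)
  \<comment> \<open>Multi-indices are extensional, with value \<open>undefined\<close> off
    \<open>{0..n}\<close>; the inverse of \<open>\<pi>\<close> fixes all points there.\<close>
  moreover have "\<alpha> (Hilbert_Choice.inv \<pi> i) = undefined" if "i \<notin> {0..n}" for i
    using assms that permutes_not_in[OF permutes_inv[OF perm] that]
    by (auto simp: multi_indices_def PiE_def extensional_def)
  ultimately show ?thesis
    using assms by (auto simp: multi_indices_def PiE_def extensional_def o_def simp del: of_nat_sum)
qed

end

end

section \<open>Alternating families of forms\<close>

text \<open>Alternation in the index list, not in the tangent vectors: it allows index lists to be
  sorted at the cost of a sign.\<close>

definition alternating :: "(nat list \<Rightarrow> ('a, 'f::field) form) \<Rightarrow> bool" where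
  "alternating F \<longleftrightarrow> (\<forall>js p. p permutes {..<length js} \<longrightarrow>
     F (permute_list p js) = form_scale (of_int (sign p)) (F js))"

text \<open>The sum in \<open>dlam\<close> is the Leibniz formula, with rows for list entries and
  columns for vectors. As a determinant it obeys the rule for permuted rows.\<close>

lemma dlam_eq_det:
  assumes "x \<in> splx v {0..n}" "length ws = length js" "set ws \<subseteq> tangent (splx v {0..n})"
  shows "dlam n v js x ws = (Determinant.det (Matrix.mat (length js) (length js)
     (\<lambda>(i, j). of_real (dbary n v (js ! i) x (ws ! j)))) :: 'f::real_normed_field)"
proof -
  have "p i < length js" if "p permutes {..<length js}" "i < length js" for p i
    using permutes_in_image[OF that(1), of i] that(2) by simp
  then show ?thesis
    using assms by (auto simp: dlam_def Determinant.det_def lessThan_atLeast0 intro!: sum.cong prod.cong)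
qed

lemma alternating_dlam: "alternating (dlam n v :: nat list \<Rightarrow> ('a::euclidean_space, 'f::real_normed_field) form)"
  unfolding alternating_def
proof (intro allI impI ext)
  fix js :: "nat list" and p x and ws :: "'a list"
  assume p: "p permutes {..<length js}"
  show "dlam n v (permute_list p js) x ws
      = (form_scale (of_int (sign p)) (dlam n v js) x ws :: 'f)"
  proof (cases "x \<in> splx v {0..n} \<and> length ws = length js \<and> set ws \<subseteq> tangent (splx v {0..n})")
    case True
    let ?A = "Matrix.mat (length js) (length js) (\<lambda>(i, j). of_real (dbary n v (js ! i) x (ws ! j)) :: 'f)"
    have "dlam n v (permute_list p js) x ws
        = Determinant.det (Matrix.mat (length js) (length js) (\<lambda>(i, j). ?A $$ (p i, j)))"
      using True p permutes_in_image[OF p]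
      by (subst dlam_eq_det)
        (auto simp: permute_list_nth lessThan_atLeast0 intro!: arg_cong[where f = Determinant.det])
    also have "\<dots> = of_int (sign p) * Determinant.det ?A"
      using p by (subst Determinant.det_permute_rows) (auto simp: lessThan_atLeast0)
    finally show ?thesis using True by (simp add: form_scale_def dlam_eq_det)
  qed (auto simp: dlam_def form_scale_def)
qed

lemma whitney_apply:
  "whitney n v \<rho> x ws = (\<Sum>i<length \<rho>. (-1) ^ i * (of_real (bary n v (\<rho> ! i) x) *
     (dlam n v (take i \<rho> @ drop (Suc i) \<rho>) x ws :: 'f::real_normed_field)))"
proof -
  have "(\<Sum>i\<in>A. f i) x ws = (\<Sum>i\<in>A. f i x ws)" for A :: "nat set" and f :: "nat \<Rightarrow> ('a, 'f) form"
    by (induction A rule: infinite_finite_induct) auto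
  then show ?thesis by (simp add: whitney_def form_scale_def fun_mult_def)
qed

text \<open>Laplace expansion along the first column, which holds the barycentric coordinates.\<close>

lemma whitney_eq_det:
  assumes "x \<in> splx v {0..n}" "Suc (length ws) = length \<rho>" "set ws \<subseteq> tangent (splx v {0..n})"
  shows "whitney n v \<rho> x ws = (Determinant.det (Matrix.mat (length \<rho>) (length \<rho>)
     (\<lambda>(i, j). of_real (if j = 0 then bary n v (\<rho> ! i) x else dbary n v (\<rho> ! i) x (ws ! (j - 1)))))
       :: 'f::real_normed_field)"
proof -
  define A :: "'f mat" where "A = Matrix.mat (length \<rho>) (length \<rho>)
     (\<lambda>(i, j). of_real (if j = 0 then bary n v (\<rho> ! i) x else dbary n v (\<rho> ! i) x (ws ! (j - 1))))"
  have A: "A \<in> carrier_mat (length \<rho>) (length \<rho>)" by (simp add: A_def)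
  have "cofactor A i 0 = (-1) ^ i * dlam n v (take i \<rho> @ drop (Suc i) \<rho>) x ws" if "i < length \<rho>" for i
  proof -
    \<comment> \<open>Deleting column 0 undoes the shift \<open>j - 1\<close>, so the minor is the
      matrix of \<open>dlam\<close> for the list without entry \<open>i\<close>.\<close>
    have "mat_delete A i 0 = Matrix.mat (length (take i \<rho> @ drop (Suc i) \<rho>)) (length (take i \<rho> @ drop (Suc i) \<rho>))
       (\<lambda>(l, j). of_real (dbary n v ((take i \<rho> @ drop (Suc i) \<rho>) ! l) x (ws ! j)))"
      using that assms(2) by (auto simp: mat_delete_def A_def nth_append min_def)
    then show ?thesis
      using that assms by (subst dlam_eq_det) (auto simp: cofactor_def)
  qed
  moreover have "0 < length \<rho>" using assms(2) by linarith
  moreover from this have "A $$ (i, 0) = of_real (bary n v (\<rho> ! i) x)" if "i < length \<rho>" for i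
    using that by (simp add: A_def)
  ultimately have "Determinant.det A = whitney n v \<rho> x ws"
    by (simp add: laplace_expansion_column[OF A, of 0] whitney_apply mult.left_commute)
  then show ?thesis by (simp add: A_def)
qed

text \<open>Permuting the list mixes the summands of a Whitney form, but in the determinant it
  merely permutes rows.\<close>

lemma alternating_whitney:
  "alternating (whitney n v :: nat list \<Rightarrow> ('a::euclidean_space, 'f::real_normed_field) form)"
  unfolding alternating_def
proof (intro allI impI ext)
  fix js :: "nat list" and p x and ws :: "'a list"
  assume p: "p permutes {..<length js}"
  show "whitney n v (permute_list p js) x ws
      = (form_scale (of_int (sign p)) (whitney n v js) x ws :: 'f)"
  proof (cases "x \<in> splx v {0..n} \<and> Suc (length ws) = length js \<and> set ws \<subseteq> tangent (splx v {0..n})")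
    case True
    let ?A = "Matrix.mat (length js) (length js)
      (\<lambda>(i, j). of_real (if j = 0 then bary n v (js ! i) x else dbary n v (js ! i) x (ws ! (j - 1))) :: 'f)"
    have "whitney n v (permute_list p js) x ws
        = Determinant.det (Matrix.mat (length js) (length js) (\<lambda>(i, j). ?A $$ (p i, j)))"
      using True p permutes_in_image[OF p]
      by (subst whitney_eq_det)
        (auto simp: permute_list_nth lessThan_atLeast0 intro!: arg_cong[where f = Determinant.det])
    also have "\<dots> = of_int (sign p) * Determinant.det ?A"
      using p by (subst Determinant.det_permute_rows) (auto simp: lessThan_atLeast0)
    finally show ?thesis using True by (simp add: form_scale_def whitney_eq_det)
  next
    case False
    \<comment> \<open>\<open>whitney\<close> has no case distinction of its own, but here each
      summand vanishes, its list having one entry fewer than \<open>js\<close>. A general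
      \<open>ks\<close> covers both \<open>js\<close> and its permutation.\<close>
    then have "dlam n v (take i ks @ drop (Suc i) ks) x ws = (0::'f)"
      if "i < length ks" "length ks = length js" for i ks
      using that by (auto simp: dlam_def)
    then show ?thesis by (simp add: form_scale_def whitney_apply)
  qed
qed

section \<open>Signs of concatenated lists\<close>

text \<open>One-line notation of a permutation, continued by the identity so that it can satisfy
  \<open>permutes\<close>.\<close>

definition list_perm :: "nat list \<Rightarrow> nat \<Rightarrow> nat" where
  "list_perm zs i = (if i < length zs then zs ! i else i)"

lemma list_perm_permutes:
  assumes "distinct zs" "set zs = {..<N}"
  shows "list_perm zs permutes {..<N}"
proof (rule bij_imp_permutes)
  have N: "length zs = N" using assms distinct_card[of zs] by simp
  have "bij_betw ((!) zs) {..<N} {..<N}"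
    by (rule bij_betw_nth[OF assms(1)]) (simp_all only: N assms(2))
  moreover have "list_perm zs i = zs ! i" if "i \<in> {..<N}" for i
    using that by (simp add: list_perm_def N)
  ultimately show "bij_betw (list_perm zs) {..<N} {..<N}"
    using bij_betw_cong[of "{..<N}" "list_perm zs" "(!) zs"] by blast
  show "\<And>x. x \<notin> {..<N} \<Longrightarrow> list_perm zs x = x" using N by (simp add: list_perm_def)
qed

text \<open>The sorted list is \<open>[0..<N]\<close>, so exactly the inverse of
  \<open>list_perm\<close> sorts the concatenation, and a permutation and its inverse have equal
  sign.\<close>

lemma concat_sign_eq:
  assumes "distinct (xs @ ys)" "set (xs @ ys) = {..<N}"
  shows "concat_sign xs ys = sign (list_perm (xs @ ys))"
proof -
  let ?zs = "xs @ ys"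
  let ?z = "list_perm ?zs"
  have N: "length ?zs = N" using assms distinct_card[of ?zs] by simp
  have z: "?z permutes {..<N}" using list_perm_permutes[OF assms] .
  have sort: "sort ?zs = [0..<N]"
    using assms by (metis distinct_sort set_sort sorted_sort sorted_distinct_set_unique
        sorted_upt distinct_upt atLeast_upt)
  have key: "permute_list p ?zs = sort ?zs \<longleftrightarrow> p = Hilbert_Choice.inv ?z"
    if p: "p permutes {..<N}" for p
  proof -
    have lt: "p i < N \<longleftrightarrow> i < N" for i using permutes_in_image[OF p, of i] by simp
    have "permute_list p ?zs = sort ?zs \<longleftrightarrow> (\<forall>i<N. ?zs ! p i = i)"
      using p N by (auto simp: sort list_eq_iff_nth_eq permute_list_nth)
    also have "\<dots> \<longleftrightarrow> (\<forall>i<N. ?z (p i) = i)"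
      using lt N by (auto simp: list_perm_def)
    also have "\<dots> \<longleftrightarrow> (\<forall>i. ?z (p i) = i)"
      using permutes_not_in[OF p] permutes_not_in[OF z] by (metis lessThan_iff)
    also have "\<dots> \<longleftrightarrow> p = Hilbert_Choice.inv ?z"
      using permutes_inverses[OF z] by (auto simp: fun_eq_iff) metis
    finally show ?thesis .
  qed
  have "(THE p. p permutes {..<length ?zs} \<and> permute_list p ?zs = sort ?zs) = Hilbert_Choice.inv ?z"
    by (rule the_equality) (use key permutes_inv[OF z] N in auto)
  then have "concat_sign xs ys = sign (Hilbert_Choice.inv ?z)"
    by (simp add: concat_sign_def)
  also have "\<dots> = sign ?z"
    by (rule sign_inverse[OF permutes_imp_permutation[OF _ z]]) simp
  finally show ?thesis .
qed

text \<open>The witness acts as \<open>p\<close> on the first block and as \<open>q\<close>, shifted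
  by \<open>length xs\<close>, on the second. The shift preserves the sign.\<close>

lemma permute_list_append:
  assumes p: "p permutes {..<length xs}" and q: "q permutes {..<length ys}"
  obtains s where "s permutes {..<length (xs @ ys)}" "sign s = sign p * sign q"
    "permute_list s (xs @ ys) = permute_list p xs @ permute_list q ys"
proof -
  let ?k = "length xs" and ?l = "length ys"
  let ?f = "\<lambda>i. ?k + i"
  let ?q = "map_permutation {..<?l} ?f q"
  have "bij_betw ?f {..<?l} {?k..<?k + ?l}"
    by (rule bij_betw_byWitness[where f' = "\<lambda>i. i - ?k"]) auto
  then have q': "?q permutes {?k..<?k + ?l}"
    by (rule map_permutation_permutes[OF _ q])
  have q1: "?q permutes {..<?k + ?l}" by (rule permutes_subset[OF q']) auto
  have p1: "p permutes {..<?k + ?l}" by (rule permutes_subset[OF p]) auto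
  have q_hi: "?q (?k + i) = ?k + q i" if "i < ?l" for i
    using map_permutation_apply[of ?f "{..<?l}" i q] that by simp
  have q_lo: "?q i = i" if "i < ?k" for i
    by (rule permutes_not_in[OF q']) (use that in auto)
  have s: "p \<circ> ?q permutes {..<length (xs @ ys)}"
    using permutes_compose[OF q1 p1] by simp
  have "sign (p \<circ> ?q) = sign p * sign ?q"
    by (intro sign_compose permutes_imp_permutation[OF finite_lessThan p1]
        permutes_imp_permutation[OF finite_lessThan q1])
  also have "sign ?q = sign q"
    by (rule sign_map_permutation[OF _ q]) simp_all
  finally have sgn: "sign (p \<circ> ?q) = sign p * sign q" .
  have "permute_list (p \<circ> ?q) (xs @ ys) = permute_list p xs @ permute_list q ys"
  proof (rule nth_equalityI)
    fix i assume "i < length (permute_list (p \<circ> ?q) (xs @ ys))"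
    then have i: "i < ?k + ?l" by simp
    show "permute_list (p \<circ> ?q) (xs @ ys) ! i = (permute_list p xs @ permute_list q ys) ! i"
    proof (cases "i < ?k")
      case True
      then have "p i < ?k" using permutes_in_image[OF p, of i] by simp
      then show ?thesis
        using True i permute_list_nth[OF s, of i] permute_list_nth[OF p, of i]
        by (simp add: nth_append q_lo)
    next
      case False
      define j where "j = i - ?k"
      have j: "i = ?k + j" "j < ?l" using i False by (simp_all add: j_def)
      have "p (?k + q j) = ?k + q j" by (rule permutes_not_in[OF p]) simp
      then show ?thesis
        using i j permute_list_nth[OF s, of i] permute_list_nth[OF q, of j]
        by (simp add: nth_append q_hi)
    qed
  qed simp
  with s sgn show thesis by (rule that)
qed

text \<open>With \<open>s\<close> the block permutation built from \<open>p\<close> and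
  \<open>q\<close>, both \<open>\<pi> \<circ> list_perm (xs @ ys)\<close> and
  \<open>list_perm (xs' @ ys') \<circ> s\<close> list the entries of
  \<open>map \<pi> (xs @ ys)\<close>. The claim compares their signs.\<close>

lemma concat_sign_permute:
  assumes \<pi>: "\<pi> permutes {..<N}"
    and xys: "distinct (xs @ ys)" "set (xs @ ys) = {..<N}"
    and xys': "distinct (xs' @ ys')" "set (xs' @ ys') = {..<N}"
    and p: "p permutes {..<length xs'}" "map \<pi> xs = permute_list p xs'"
    and q: "q permutes {..<length ys'}" "map \<pi> ys = permute_list q ys'"
  shows "sign \<pi> * concat_sign xs ys = sign p * sign q * concat_sign xs' ys'"
proof -
  obtain s where s: "s permutes {..<length (xs' @ ys')}" "sign s = sign p * sign q"
    "permute_list s (xs' @ ys') = permute_list p xs' @ permute_list q ys'"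
    using permute_list_append[OF p(1) q(1)] .
  have N: "length (xs @ ys) = N" "length (xs' @ ys') = N"
    using distinct_card[OF xys(1)] distinct_card[OF xys'(1)]
    unfolding xys(2) xys'(2) by simp_all
  note perms = permutes_imp_permutation[OF finite_lessThan \<pi>]
    permutes_imp_permutation[OF finite_lessThan s(1)]
    permutes_imp_permutation[OF finite_lessThan list_perm_permutes[OF xys]]
    permutes_imp_permutation[OF finite_lessThan list_perm_permutes[OF xys']]
  have "\<pi> \<circ> list_perm (xs @ ys) = list_perm (xs' @ ys') \<circ> s"
  proof
    fix i
    show "(\<pi> \<circ> list_perm (xs @ ys)) i = (list_perm (xs' @ ys') \<circ> s) i"
    proof (cases "i < N")
      case True
      have "map \<pi> (xs @ ys) ! i = permute_list s (xs' @ ys') ! i"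
        by (simp only: map_append p(2) q(2) s(3))
      moreover have "s i < N" using True permutes_in_image[OF s(1), of i] N by simp
      ultimately show ?thesis
        using True N permute_list_nth[OF s(1), of i]
        by (simp add: list_perm_def del: length_append map_append)
    next
      case False
      then show ?thesis
        using N permutes_not_in[OF \<pi>, of i] permutes_not_in[OF s(1), of i]
        by (simp add: list_perm_def)
    qed
  qed
  then have "sign \<pi> * sign (list_perm (xs @ ys)) = sign (list_perm (xs' @ ys')) * sign s"
    unfolding sign_compose[OF perms(1,3), symmetric] sign_compose[OF perms(4,2), symmetric] by simp
  then show ?thesis
    using s(2) by (simp add: concat_sign_eq[OF xys] concat_sign_eq[OF xys'])
qed

text \<open>\<open>\<tau>\<close> is the sorted image of \<open>\<sigma>\<close>. A bijection maps
  complements to complements, which gives \<open>q\<close>. The two sign identities serve the two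
  orders of concatenation in \<open>canonical_I\<close> and \<open>canonical_J\<close>.\<close>

lemma sort_permuted:
  assumes \<pi>: "\<pi> permutes {0..n}" and \<sigma>: "sorted_wrt (<) \<sigma>" "set \<sigma> \<subseteq> {0..n}"
  obtains \<tau> p q where "sorted_wrt (<) \<tau>" "length \<tau> = length \<sigma>" "set \<tau> \<subseteq> {0..n}"
    "p permutes {..<length \<tau>}" "map \<pi> \<sigma> = permute_list p \<tau>"
    "q permutes {..<length (compl_list n \<tau>)}"
    "map \<pi> (compl_list n \<sigma>) = permute_list q (compl_list n \<tau>)"
    "sign \<pi> * concat_sign \<sigma> (compl_list n \<sigma>) = sign p * sign q * concat_sign \<tau> (compl_list n \<tau>)"
    "sign \<pi> * concat_sign (compl_list n \<sigma>) \<sigma> = sign p * sign q * concat_sign (compl_list n \<tau>) \<tau>"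
proof -
  have compl: "distinct (compl_list n js)" "set (compl_list n js) = {0..n} - set js" for js
    by (simp_all add: compl_list_def)
  have inj: "inj \<pi>" using permutes_inj[OF \<pi>] .
  have dist: "distinct \<sigma>" using \<sigma>(1) strict_sorted_iff by blast
  define \<tau> where "\<tau> = sort (map \<pi> \<sigma>)"
  have set_\<tau>: "set \<tau> = \<pi> ` set \<sigma>" by (simp add: \<tau>_def)
  have \<tau>: "sorted_wrt (<) \<tau>" "length \<tau> = length \<sigma>" "set \<tau> \<subseteq> {0..n}" "distinct \<tau>"
    using dist \<sigma>(2) permutes_image[OF \<pi>] inj_on_subset[OF inj, of "set \<sigma>"]
    by (auto simp: \<tau>_def strict_sorted_iff distinct_map)
  have "mset (map \<pi> \<sigma>) = mset \<tau>" by (simp add: \<tau>_def)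
  then obtain p where p: "p permutes {..<length \<tau>}" "permute_list p \<tau> = map \<pi> \<sigma>"
    by (rule mset_eq_permutation)
  have "set (map \<pi> (compl_list n \<sigma>)) = set (compl_list n \<tau>)"
    using permutes_image[OF \<pi>] by (simp add: compl set_\<tau> image_set_diff[OF inj])
  moreover have "distinct (map \<pi> (compl_list n \<sigma>))"
    using compl inj_on_subset[OF inj] by (auto simp: distinct_map)
  ultimately have "mset (map \<pi> (compl_list n \<sigma>)) = mset (compl_list n \<tau>)"
    using compl(1) set_eq_iff_mset_eq_distinct by blast
  then obtain q where q: "q permutes {..<length (compl_list n \<tau>)}"
    "permute_list q (compl_list n \<tau>) = map \<pi> (compl_list n \<sigma>)"
    by (rule mset_eq_permutation)
  have \<pi>': "\<pi> permutes {..<Suc n}" using \<pi> by (simp add: atLeast0AtMost lessThan_Suc_atMost)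
  have whole: "distinct (js @ compl_list n js)" "set (js @ compl_list n js) = {..<Suc n}"
      "distinct (compl_list n js @ js)" "set (compl_list n js @ js) = {..<Suc n}"
    if "distinct js" "set js \<subseteq> {0..n}" for js
    using that by (auto simp: compl)
  \<comment> \<open>In the second instance the complement comes first, so \<open>p\<close> and
    \<open>q\<close> change places.\<close>
  note signs = concat_sign_permute[OF \<pi>' whole(1,2)[OF dist \<sigma>(2)] whole(1,2)[OF \<tau>(4,3)] p(1) p(2)[symmetric] q(1) q(2)[symmetric]]
    concat_sign_permute[OF \<pi>' whole(3,4)[OF dist \<sigma>(2)] whole(3,4)[OF \<tau>(4,3)] q(1) q(2)[symmetric] p(1) p(2)[symmetric]]
  show thesis
    by (rule that[OF \<tau>(1-3) p(1) p(2)[symmetric] q(1) q(2)[symmetric] signs(1)])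
      (use signs(2) in \<open>simp add: mult.commute\<close>)
qed

section \<open>Equivariance of the canonical isomorphisms\<close>

text \<open>Both sides are linear in the form, but \<open>L\<close> is known to be linear on the
  span only; the induction therefore carries invariance of the span under \<open>T\<close> along
  with the equation.\<close>

lemma equivariant_from_generators:
  fixes T L :: "('a, 'f::field) form \<Rightarrow> ('a, 'f) form"
  assumes lin: "form_linear_on (forms.span B) L" and bij: "bij_betw L (forms.span B) W"
    and T_add: "\<And>\<omega> \<eta>. T (\<omega> + \<eta>) = T \<omega> + T \<eta>"
    and T_scale: "\<And>c \<omega>. T (form_scale c \<omega>) = form_scale c (T \<omega>)"
    and gen: "\<And>b. b \<in> B \<Longrightarrow> T b \<in> forms.span B \<and> T (L b) = form_scale \<epsilon> (L (T b))"
    and \<epsilon>: "\<epsilon> * \<epsilon> = 1"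
  shows "\<forall>\<omega>\<in>forms.span B. T (L \<omega>) = form_scale \<epsilon> (L (T \<omega>))"
    and "\<forall>\<omega>\<in>W. T (inv_into (forms.span B) L \<omega>) = form_scale \<epsilon> (inv_into (forms.span B) L (T \<omega>))"
proof -
  let ?V = "forms.span B"
  have L_add: "L (\<omega> + \<eta>) = L \<omega> + L \<eta>" if "\<omega> \<in> ?V" "\<eta> \<in> ?V" for \<omega> \<eta>
    using lin that by (simp add: form_linear_on_def)
  have L_scale: "L (form_scale c \<omega>) = form_scale c (L \<omega>)" if "\<omega> \<in> ?V" for c \<omega>
    using lin that by (simp add: form_linear_on_def)
  have T0: "T 0 = 0" using T_scale[of 0 0] by simp
  have L0: "L 0 = 0" using L_scale[OF forms.span_zero, of 0] by simp
  \<comment> \<open>Membership of \<open>\<omega>\<close> is part of the claim so that the induction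
    step may use additivity of \<open>L\<close>.\<close>
  have *: "\<omega> \<in> ?V \<and> T \<omega> \<in> ?V \<and> T (L \<omega>) = form_scale \<epsilon> (L (T \<omega>))" if "\<omega> \<in> ?V" for \<omega>
    using that
  proof (induction rule: forms.span_induct_alt)
    case base
    then show ?case
      by (simp only: T0 L0 forms.span_zero forms.scale_zero_right simp_thms)
  next
    case (step c b \<eta>)
    have b: "b \<in> ?V" using step forms.span_base by blast
    show ?case
      using step b gen[OF step(1)]
      by (simp only: T_add T_scale L_add L_scale forms.span_add forms.span_scale
          forms.scale_right_distrib forms.scale_left_commute simp_thms)
  qed
  then show "\<forall>\<omega>\<in>?V. T (L \<omega>) = form_scale \<epsilon> (L (T \<omega>))" by blast
  show "\<forall>\<omega>\<in>W. T (inv_into ?V L \<omega>) = form_scale \<epsilon> (inv_into ?V L (T \<omega>))"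
  proof
    fix \<omega> assume "\<omega> \<in> W"
    define \<eta> where "\<eta> = inv_into ?V L \<omega>"
    have \<eta>: "\<eta> \<in> ?V" "L \<eta> = \<omega>"
      using \<open>\<omega> \<in> W\<close> bij unfolding \<eta>_def bij_betw_def by (auto intro: inv_into_into f_inv_into_f)
    \<comment> \<open>This exhibits \<open>T \<omega>\<close> as a value of \<open>L\<close> on the
      span, so the inverse can be evaluated at it; \<open>\<epsilon> * \<epsilon> = 1\<close> then
      moves the sign across.\<close>
    have "T \<omega> = L (form_scale \<epsilon> (T \<eta>))"
      using *[OF \<eta>(1)] \<eta>(2) by (simp add: L_scale)
    moreover have "form_scale \<epsilon> (T \<eta>) \<in> ?V"
      using *[OF \<eta>(1)] by (simp add: forms.span_scale)
    ultimately have "inv_into ?V L (T \<omega>) = form_scale \<epsilon> (T \<eta>)"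
      using bij by (simp add: bij_betw_def)
    then show "T (inv_into ?V L \<omega>) = form_scale \<epsilon> (inv_into ?V L (T \<omega>))"
      by (simp add: \<eta>_def[symmetric] \<epsilon>)
  qed
qed

lemma fun_mult_scale: "fun_mult g (form_scale c \<omega>) = form_scale c (fun_mult g \<omega>)"
  by (simp add: fun_mult_def form_scale_def mult.left_commute)

lemma lam_prod_permute_list:
  assumes "p permutes {..<length js}"
  shows "lam_prod n v (permute_list p js) = lam_prod n v js"
proof
  fix x
  show "lam_prod n v (permute_list p js) x = lam_prod n v js x"
    unfolding lam_prod_def using prod.permute[OF assms, of "\<lambda>i. bary n v (js ! i) x"]
    by (simp add: permute_list_nth[OF assms])
qed

context affine_simplex
begin

text \<open>One argument for both isomorphisms: \<open>F\<close> and \<open>G\<close> are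
  \<open>dlam\<close> and \<open>whitney\<close> in either order, and \<open>e\<close> is the
  matching concatenation sign. The index set is spelled out because \<open>Sigma1\<close> and
  \<open>Sigma0\<close> differ only in the length \<open>m\<close>.\<close>

lemma canonical_equivariant:
  fixes F G :: "nat list \<Rightarrow> ('a, 'f::real_normed_field) form" and d :: int and m :: nat
  defines "S \<equiv> {\<sigma>. length \<sigma> = m \<and> sorted_wrt (<) \<sigma> \<and> set \<sigma> \<subseteq> {0..n}}"
  defines "V \<equiv> forms.span {fun_mult (lam_pow n v \<alpha>) (F \<sigma>) |\<alpha> \<sigma>. \<alpha> \<in> multi_indices d n \<and> \<sigma> \<in> S}"
  assumes \<pi>: "\<pi> permutes {0..n}"
    and F: "alternating F" "\<And>js. set js \<subseteq> {0..n} \<Longrightarrow> sym_pullback n v \<pi> (F js) = F (map \<pi> js)"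
    and G: "alternating G" "\<And>js. set js \<subseteq> {0..n} \<Longrightarrow> sym_pullback n v \<pi> (G js) = G (map \<pi> js)"
    and e: "e = (\<lambda>\<sigma>. concat_sign \<sigma> (compl_list n \<sigma>)) \<or> e = (\<lambda>\<sigma>. concat_sign (compl_list n \<sigma>) \<sigma>)"
    and L: "form_linear_on V L" "bij_betw L V W"
    and L_gen: "\<forall>\<alpha>\<in>multi_indices d n. \<forall>\<sigma>\<in>S. L (fun_mult (lam_pow n v \<alpha>) (F \<sigma>)) =
      form_scale (of_int (e \<sigma>)) (fun_mult (\<lambda>x. lam_pow n v \<alpha> x * lam_prod n v \<sigma> x) (G (compl_list n \<sigma>)))"
  shows "\<forall>\<omega>\<in>V. sym_pullback n v \<pi> (L \<omega>) = form_scale (of_int (sign \<pi>)) (L (sym_pullback n v \<pi> \<omega>))"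
    and "\<forall>\<omega>\<in>W. sym_pullback n v \<pi> (inv_into V L \<omega>) =
      form_scale (of_int (sign \<pi>)) (inv_into V L (sym_pullback n v \<pi> \<omega>))"
proof -
  let ?T = "sym_pullback n v \<pi> :: ('a, 'f) form \<Rightarrow> ('a, 'f) form"
  let ?b = "\<lambda>\<alpha> \<sigma>. fun_mult (lam_pow n v \<alpha>) (F \<sigma>)"
  let ?c = "\<lambda>\<alpha> \<sigma>. fun_mult (\<lambda>x. lam_pow n v \<alpha> x * lam_prod n v \<sigma> x) (G (compl_list n \<sigma>))"
  have gen: "?T b \<in> V \<and> ?T (L b) = form_scale (of_int (sign \<pi>)) (L (?T b))"
    if b: "b \<in> {?b \<alpha> \<sigma> |\<alpha> \<sigma>. \<alpha> \<in> multi_indices d n \<and> \<sigma> \<in> S}" for b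
  proof -
    obtain \<alpha> \<sigma> where \<alpha>: "\<alpha> \<in> multi_indices d n" and "\<sigma> \<in> S" and b: "b = ?b \<alpha> \<sigma>"
      using b by blast
    then have \<sigma>: "length \<sigma> = m" "sorted_wrt (<) \<sigma>" "set \<sigma> \<subseteq> {0..n}" by (simp_all add: S_def)
    define \<alpha>' where "\<alpha>' = \<alpha> \<circ> Hilbert_Choice.inv \<pi>"
    obtain \<tau> p q where \<tau>: "sorted_wrt (<) \<tau>" "length \<tau> = length \<sigma>" "set \<tau> \<subseteq> {0..n}"
      and p: "p permutes {..<length \<tau>}" "map \<pi> \<sigma> = permute_list p \<tau>"
      and q: "q permutes {..<length (compl_list n \<tau>)}"
        "map \<pi> (compl_list n \<sigma>) = permute_list q (compl_list n \<tau>)"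
      and "sign \<pi> * concat_sign \<sigma> (compl_list n \<sigma>) = sign p * sign q * concat_sign \<tau> (compl_list n \<tau>)"
        "sign \<pi> * concat_sign (compl_list n \<sigma>) \<sigma> = sign p * sign q * concat_sign (compl_list n \<tau>) \<tau>"
      using sort_permuted[OF \<pi> \<sigma>(2,3)] .
    then have "sign \<pi> * e \<sigma> = sign p * sign q * e \<tau>" using e by blast
    \<comment> \<open>Multiplication by \<open>sign \<pi> * sign q\<close> produces squares of
      signs, which cancel.\<close>
    then have "(sign \<pi> * sign \<pi>) * (e \<sigma> * sign q) = sign \<pi> * (sign p * (sign q * sign q) * e \<tau>)"
      by (simp only: ac_simps)
    then have sgn: "e \<sigma> * sign q = sign \<pi> * (sign p * e \<tau>)"
      by (simp only: sign_idempotent mult_1_left mult_1_right ac_simps)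
    have \<alpha>': "\<alpha>' \<in> multi_indices d n" using multi_indices_comp_inv[OF \<pi> \<alpha>] by (simp add: \<alpha>'_def)
    have "\<tau> \<in> S" using \<tau> \<sigma> by (simp add: S_def)
    have "?b \<alpha>' \<tau> \<in> V"
      unfolding V_def by (rule forms.span_base) (use \<alpha>' \<open>\<tau> \<in> S\<close> in blast)
    have compl_le: "set (compl_list n \<sigma>) \<subseteq> {0..n}" by (auto simp: compl_list_def)
    have "?T (?b \<alpha> \<sigma>) = fun_mult (lam_pow n v \<alpha>') (F (map \<pi> \<sigma>))"
      using F(2)[OF \<sigma>(3)] lam_pow_simplex_sym[OF \<pi>]
      by (subst sym_pullback_fun_mult[where h = "lam_pow n v \<alpha>'"]) (simp_all add: \<alpha>'_def)
    also have "\<dots> = form_scale (of_int (sign p)) (?b \<alpha>' \<tau>)"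
      using F(1) p by (simp add: alternating_def fun_mult_scale)
    finally have Tb: "?T (?b \<alpha> \<sigma>) = form_scale (of_int (sign p)) (?b \<alpha>' \<tau>)" .
    have "L (?T (?b \<alpha> \<sigma>)) = form_scale (of_int (sign p)) (L (?b \<alpha>' \<tau>))"
      unfolding Tb using L(1) \<open>?b \<alpha>' \<tau> \<in> V\<close> by (simp add: form_linear_on_def)
    also have "\<dots> = form_scale (of_int (sign p * e \<tau>)) (?c \<alpha>' \<tau>)"
      using L_gen \<alpha>' \<open>\<tau> \<in> S\<close> by simp
    finally have LT: "L (?T (?b \<alpha> \<sigma>)) = form_scale (of_int (sign p * e \<tau>)) (?c \<alpha>' \<tau>)" .
    have "?T (?c \<alpha> \<sigma>) = fun_mult (\<lambda>x. lam_pow n v \<alpha>' x * lam_prod n v (map \<pi> \<sigma>) x)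
        (G (map \<pi> (compl_list n \<sigma>)))"
      using G(2)[OF compl_le] lam_pow_simplex_sym[OF \<pi>] lam_prod_simplex_sym[OF \<pi> _ \<sigma>(3)]
      by (subst sym_pullback_fun_mult[where h = "\<lambda>x. lam_pow n v \<alpha>' x * lam_prod n v (map \<pi> \<sigma>) x"])
        (simp_all add: \<alpha>'_def)
    \<comment> \<open>Only \<open>q\<close> contributes a sign: \<open>lam_prod\<close> does not
      depend on the order of its list.\<close>
    also have "\<dots> = form_scale (of_int (sign q)) (?c \<alpha>' \<tau>)"
      using G(1) p q by (simp add: alternating_def fun_mult_scale lam_prod_permute_list)
    finally have "?T (L (?b \<alpha> \<sigma>)) = form_scale (of_int (e \<sigma> * sign q)) (?c \<alpha>' \<tau>)"
      using L_gen \<alpha> \<open>\<sigma> \<in> S\<close> by (simp add: sym_pullback_scale)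
    also have "\<dots> = form_scale (of_int (sign \<pi>)) (L (?T (?b \<alpha> \<sigma>)))"
      unfolding LT sgn by simp
    finally show ?thesis
      using \<open>?b \<alpha>' \<tau> \<in> V\<close> unfolding b Tb V_def by (simp add: forms.span_scale)
  qed
  have sq: "of_int (sign \<pi>) * of_int (sign \<pi>) = (1::'f)"
    by (simp flip: of_int_mult)
  note * = equivariant_from_generators[of _ L W ?T "of_int (sign \<pi>)", OF L[unfolded V_def]
      sym_pullback_add sym_pullback_scale gen[unfolded V_def] sq]
  show "\<forall>\<omega>\<in>V. ?T (L \<omega>) = form_scale (of_int (sign \<pi>)) (L (?T \<omega>))"
    unfolding V_def by (rule *(1))
  show "\<forall>\<omega>\<in>W. ?T (inv_into V L \<omega>) = form_scale (of_int (sign \<pi>)) (inv_into V L (?T \<omega>))"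
    unfolding V_def by (rule *(2))
qed

text \<open>The case \<open>k > n\<close>: \<open>{0}\<close> is the span of no generators, so the
  condition on generators is vacuous.\<close>

lemma zero_equivariant:
  fixes L :: "('a, 'f::real_normed_field) form \<Rightarrow> ('a, 'f) form"
  assumes "form_linear_on {0} L" "bij_betw L {0} W"
  shows "\<forall>\<omega>\<in>{0}. sym_pullback n v \<pi> (L \<omega>) = form_scale (of_int (sign \<pi>)) (L (sym_pullback n v \<pi> \<omega>))"
    and "\<forall>\<omega>\<in>W. sym_pullback n v \<pi> (inv_into {0} L \<omega>) =
      form_scale (of_int (sign \<pi>)) (inv_into {0} L (sym_pullback n v \<pi> \<omega>))"
  using equivariant_from_generators[of "{}" L W "sym_pullback n v \<pi>" "of_int (sign \<pi>)",
      OF _ _ sym_pullback_add sym_pullback_scale] assms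
  unfolding forms.span_empty by (simp_all flip: of_int_mult)

end

section \<open>Specialization to the two canonical isomorphisms\<close>

theorem theorem6p2:
  fixes v :: "nat \<Rightarrow> 'a::euclidean_space"
    and n k r :: nat
    and \<pi> :: "nat \<Rightarrow> nat"
    and I J :: "('a, 'f::real_normed_field) form \<Rightarrow> ('a, 'f) form"
  assumes "inj_on v {0..n}" and "\<not> affine_dependent (v ` {0..n})"
    and "canonical_I n v k r I"
    and "canonical_J n v k r J"
    and "\<pi> permutes {0..n}"
  shows "(\<forall>\<omega> \<in> poly_forms n v r (int k).
           sym_pullback n v \<pi> (I \<omega>) =
             form_scale (of_int (sign \<pi>)) (I (sym_pullback n v \<pi> \<omega>))) \<and>
         (\<forall>\<omega> \<in> trimmed_forms n v (r + 1) (int k).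
           sym_pullback n v \<pi> (J \<omega>) =
             form_scale (of_int (sign \<pi>)) (J (sym_pullback n v \<pi> \<omega>))) \<and>
         (\<forall>\<omega> \<in> trimmed_forms0 n v (r + k + 1) (int n - int k).
           sym_pullback n v \<pi> (inv_into (poly_forms n v r (int k)) I \<omega>) =
             form_scale (of_int (sign \<pi>))
               (inv_into (poly_forms n v r (int k)) I (sym_pullback n v \<pi> \<omega>))) \<and>
         (\<forall>\<omega> \<in> poly_forms0 n v (r + k + 1) (int n - int k).
           sym_pullback n v \<pi> (inv_into (trimmed_forms n v (r + 1) (int k)) J \<omega>) =
             form_scale (of_int (sign \<pi>))
               (inv_into (trimmed_forms n v (r + 1) (int k)) J (sym_pullback n v \<pi> \<omega>)))"
proof -
  interpret affine_simplex n v
    using assms(1,2) by unfold_locales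
  note \<pi> = assms(5)
  note I = assms(3)[unfolded canonical_I_def] and J = assms(4)[unfolded canonical_J_def]
  note dlam = alternating_dlam sym_pullback_dlam[OF \<pi>]
    and whitney = alternating_whitney sym_pullback_whitney[OF \<pi>]
  have "(\<forall>\<omega> \<in> poly_forms n v r (int k).
           sym_pullback n v \<pi> (I \<omega>) = form_scale (of_int (sign \<pi>)) (I (sym_pullback n v \<pi> \<omega>))) \<and>
        (\<forall>\<omega> \<in> trimmed_forms0 n v (r + k + 1) (int n - int k).
           sym_pullback n v \<pi> (inv_into (poly_forms n v r (int k)) I \<omega>) =
             form_scale (of_int (sign \<pi>)) (inv_into (poly_forms n v r (int k)) I (sym_pullback n v \<pi> \<omega>)))"
  \<comment> \<open>For \<open>k > n\<close> the space is \<open>{0}\<close> by convention and is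
    not given as a span of generators.\<close>
  proof (cases "k \<le> n")
    case True
    then have V: "poly_forms n v r (int k) = forms.span {fun_mult (lam_pow n v \<alpha>) (dlam n v \<sigma> :: ('a, 'f) form) |\<alpha> \<sigma>.
        \<alpha> \<in> multi_indices (int r) n \<and> \<sigma> \<in> {\<sigma>. length \<sigma> = k \<and> sorted_wrt (<) \<sigma> \<and> set \<sigma> \<subseteq> {0..n}}}"
      by (simp add: poly_forms_def Sigma1_def)
    note * = canonical_equivariant[OF \<pi> dlam whitney disjI1[OF refl]
        I[unfolded V Sigma1_def, THEN conjunct1] I[unfolded V Sigma1_def, THEN conjunct2, THEN conjunct1]
        I[unfolded V Sigma1_def, THEN conjunct2, THEN conjunct2]]
    show ?thesis unfolding V using * by blast
  next
    case False
    then have V: "poly_forms n v r (int k) = ({0} :: ('a, 'f) form set)"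
      by (simp add: poly_forms_def)
    show ?thesis using zero_equivariant[of I] I unfolding V by blast
  qed
  moreover have "(\<forall>\<omega> \<in> trimmed_forms n v (r + 1) (int k).
           sym_pullback n v \<pi> (J \<omega>) = form_scale (of_int (sign \<pi>)) (J (sym_pullback n v \<pi> \<omega>))) \<and>
        (\<forall>\<omega> \<in> poly_forms0 n v (r + k + 1) (int n - int k).
           sym_pullback n v \<pi> (inv_into (trimmed_forms n v (r + 1) (int k)) J \<omega>) =
             form_scale (of_int (sign \<pi>)) (inv_into (trimmed_forms n v (r + 1) (int k)) J (sym_pullback n v \<pi> \<omega>)))"
  proof (cases "k \<le> n")
    case True
    \<comment> \<open>The trimmed space of degree \<open>r + 1\<close> has multi-indices of degree
      \<open>r\<close>, matching \<open>canonical_J\<close>; lists in \<open>Sigma0 k n\<close> have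
      \<open>Suc k\<close> entries.\<close>
    then have V: "trimmed_forms n v (r + 1) (int k) = forms.span {fun_mult (lam_pow n v \<alpha>) (whitney n v \<sigma> :: ('a, 'f) form) |\<alpha> \<sigma>.
        \<alpha> \<in> multi_indices (int r) n \<and> \<sigma> \<in> {\<sigma>. length \<sigma> = Suc k \<and> sorted_wrt (<) \<sigma> \<and> set \<sigma> \<subseteq> {0..n}}}"
      by (simp add: trimmed_forms_def Sigma0_def)
    \<comment> \<open>The roles of \<open>dlam\<close> and \<open>whitney\<close> are exchanged, and
      the sign is the one with the complement first.\<close>
    note * = canonical_equivariant[OF \<pi> whitney dlam disjI2[OF refl]
        J[unfolded V Sigma0_def, THEN conjunct1] J[unfolded V Sigma0_def, THEN conjunct2, THEN conjunct1]
        J[unfolded V Sigma0_def, THEN conjunct2, THEN conjunct2]]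
    show ?thesis unfolding V using * by blast
  next
    case False
    then have V: "trimmed_forms n v (r + 1) (int k) = ({0} :: ('a, 'f) form set)"
      by (simp add: trimmed_forms_def)
    show ?thesis using zero_equivariant[of J] J unfolding V by blast
  qed
  ultimately show ?thesis by blast
qed

end
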